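(* Let $N\ge 1$ be an integer, let $a_0,a_1,\dots,a_N\in\mathbb{R}$ with $a_N\neq 0$, and consider the linear ordinary differential equation $a_0y+a_1\dot y+\dots+a_Ny^{(N)}=0$. Let $\{\sigma_1(t),\dots,\sigma_N(t)\}$ be a basis of its real solution space (the $\sigma_i$ are then also a basis over $\mathbb{C}$ of the space of complex-valued solutions). Let $M$ be an integer with $0\le M<N$. Consider the two-point boundary value problem: given arbitrary values for $y(0),\dot y(0),\dots,y^{(M)}(0)$ and $y(T),\dot y(T),\dots,y^{(N-M-2)}(T)$ ($N$ conditions in total; no condition at $T$ if $M=N-1$), find a solution $y(t)=c_1\sigma_1(t)+\dots+c_N\sigma_N(t)$, with $c_1,\dots,c_N\in\mathbb{C}$, taking these values. This problem is almost always solvable.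
   Context: The differential equation plays the role of the Euler-Lagrange equation of a single-variable linear quadratic problem on the time horizon $[0,T]$. The two-point boundary value problem is said to be almost always solvable if, for every $T>0$ except perhaps for isolated values of $T$, its solution exists and is unique for any prescribed boundary values. Equivalently, for all $T>0$ outside a set of isolated points, the $N\times N$ matrix $W(T)$ with rows $(\sigma_1^{(i)}(0),\dots,\sigma_N^{(i)}(0))$, $0\le i\le M$, followed by $(\sigma_1^{(j)}(T),\dots,\sigma_N^{(j)}(T))$, $0\le j\le N-M-2$, is invertible. *)

theory Defs
  imports "HOL-Analysis.Analysis"
begin

(* Codomain-polymorphic, so that it covers both the real basis functions and their
   complex combinations; deriv does not apply to functions real => complex. *)
definition nth_deriv :: "nat \<Rightarrow> (real \<Rightarrow> 'a::real_normed_vector) \<Rightarrow> real \<Rightarrow> 'a" where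
  "nth_deriv k y = ((\<lambda>f t. vector_derivative f (at t)) ^^ k) y"

(* vector_derivative is total, so N-fold differentiability has to be demanded explicitly. *)
definition ode_solution ::
  "nat \<Rightarrow> (nat \<Rightarrow> real) \<Rightarrow> (real \<Rightarrow> 'a::real_normed_vector) \<Rightarrow> bool" where
  "ode_solution N a y \<longleftrightarrow>
     (\<forall>k<N. \<forall>t. nth_deriv k y differentiable (at t)) \<and>
     (\<forall>t. (\<Sum>k\<le>N. a k *\<^sub>R nth_deriv k y t) = 0)"

definition solution_basis ::
  "nat \<Rightarrow> (nat \<Rightarrow> real) \<Rightarrow> (nat \<Rightarrow> real \<Rightarrow> real) \<Rightarrow> bool" where
  "solution_basis N a \<sigma> \<longleftrightarrow>
     (\<forall>i\<in>{1..N}. ode_solution N a (\<sigma> i)) \<and>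
     (\<forall>c :: nat \<Rightarrow> real. (\<forall>t. (\<Sum>i=1..N. c i * \<sigma> i t) = 0) \<longrightarrow> (\<forall>i\<in>{1..N}. c i = 0)) \<and>
     (\<forall>y :: real \<Rightarrow> real. ode_solution N a y \<longrightarrow>
        (\<exists>c :: nat \<Rightarrow> real. \<forall>t. y t = (\<Sum>i=1..N. c i * \<sigma> i t)))"

(* For M < N the derivatives of order j < N - M - 1 at T are those of order 0, ..., N - M - 2;
   there are none of them if M = N - 1. *)
definition bvp_solution ::
  "nat \<Rightarrow> (nat \<Rightarrow> real) \<Rightarrow> (nat \<Rightarrow> real \<Rightarrow> real) \<Rightarrow> nat \<Rightarrow> real \<Rightarrow>
   (nat \<Rightarrow> complex) \<Rightarrow> (nat \<Rightarrow> complex) \<Rightarrow> (real \<Rightarrow> complex) \<Rightarrow> bool" where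
  "bvp_solution N a \<sigma> M T u v y \<longleftrightarrow>
     ode_solution N a y \<and>
     (\<exists>c :: nat \<Rightarrow> complex. \<forall>t. y t = (\<Sum>i=1..N. c i * of_real (\<sigma> i t))) \<and>
     (\<forall>i\<le>M. nth_deriv i y 0 = u i) \<and>
     (\<forall>j<N - M - 1. nth_deriv j y T = v j)"

definition bvp_uniquely_solvable ::
  "nat \<Rightarrow> (nat \<Rightarrow> real) \<Rightarrow> (nat \<Rightarrow> real \<Rightarrow> real) \<Rightarrow> nat \<Rightarrow> real \<Rightarrow> bool" where
  "bvp_uniquely_solvable N a \<sigma> M T \<longleftrightarrow> (\<forall>u v. \<exists>!y. bvp_solution N a \<sigma> M T u v y)"

(* "discrete S" says that every point of S is isolated in S. Accumulation points outside of S
   are not excluded by it, but in (0,\<infinity>) there are none, the exceptional set being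
   relatively closed there (it is the zero set of a continuous determinant). *)
definition bvp_almost_always_solvable ::
  "nat \<Rightarrow> (nat \<Rightarrow> real) \<Rightarrow> (nat \<Rightarrow> real \<Rightarrow> real) \<Rightarrow> nat \<Rightarrow> bool" where
  "bvp_almost_always_solvable N a \<sigma> M \<longleftrightarrow>
     discrete {T. T > 0 \<and> \<not> bvp_uniquely_solvable N a \<sigma> M T}"

end

theory Submission
  imports Defs "HOL-Complex_Analysis.Conformal_Mappings" "Jordan_Normal_Form.Determinant"
begin

text \<open>Every solution is the restriction of an entire function: by the recurrence its derivatives
  grow at most geometrically. Hence \<open>det W(T)\<close> is the restriction of an entire function, and it
  suffices to find one \<open>T > 0\<close> at which it does not vanish. Any small \<open>T\<close> will do: a solution
  with vanishing boundary data has \<open>N\<close> zeros in \<open>[0,T]\<close>, counted with multiplicity, so by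
  Rolle each derivative of order \<open>k < N\<close> has a zero there. Integrating from these zeros bounds
  the \<open>k\<close>-th derivative by \<open>T\<^sup>N\<^sup>-\<^sup>k\<close> times the maximum of the
  \<open>N\<close>-th one, and the equation then forces that maximum to be \<open>0\<close>.\<close>

section \<open>Iterated derivatives of solutions\<close>

lemma nth_deriv_0 [simp]: "nth_deriv 0 y = y"
  by (simp add: nth_deriv_def)

lemma nth_deriv_Suc: "nth_deriv (Suc k) y t = vector_derivative (nth_deriv k y) (at t)"
  by (simp add: nth_deriv_def)

lemma nth_deriv_nth_deriv: "nth_deriv k (nth_deriv j y) = nth_deriv (k + j) y"
  by (simp add: nth_deriv_def funpow_add)

lemma nth_deriv_SucI:
  assumes "\<And>t. (nth_deriv k y has_vector_derivative f t) (at t)"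
  shows "nth_deriv (Suc k) y = f"
  using assms by (auto simp: nth_deriv_Suc fun_eq_iff intro!: vector_derivative_at)

text \<open>\<open>ode_solution\<close> grants only \<open>N\<close> differentiations. The equation
  makes the \<open>N\<close>-th derivative a combination of lower ones, hence differentiable again,
  and differentiating it yields the next recurrence; so both claims go through one
  induction.\<close>

lemma ode_solution_recurrence_aux:
  assumes y: "ode_solution N a y" and aN: "a N \<noteq> 0"
  shows "(\<forall>m<n + N. \<forall>t. (nth_deriv m y has_vector_derivative nth_deriv (Suc m) y t) (at t)) \<and>
    (\<forall>t. nth_deriv (n + N) y t = -(\<Sum>k<N. (a k / a N) *\<^sub>R nth_deriv (n + k) y t))"
proof (induction n)
  case 0
  have "nth_deriv N y t = -(\<Sum>k<N. (a k / a N) *\<^sub>R nth_deriv k y t)" for t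
  proof -
    have "(\<Sum>k<N. a k *\<^sub>R nth_deriv k y t) + a N *\<^sub>R nth_deriv N y t = 0"
      using y by (simp add: ode_solution_def flip: lessThan_Suc_atMost)
    then have "a N *\<^sub>R nth_deriv N y t = -(\<Sum>k<N. a k *\<^sub>R nth_deriv k y t)"
      by (simp add: add_eq_0_iff)
    then have "(1 / a N) *\<^sub>R (a N *\<^sub>R nth_deriv N y t) =
        (1 / a N) *\<^sub>R (-(\<Sum>k<N. a k *\<^sub>R nth_deriv k y t))"
      by simp
    then show ?thesis
      using aN by (simp add: scaleR_right.sum)
  qed
  moreover have "(nth_deriv m y has_vector_derivative nth_deriv (Suc m) y t) (at t)"
    if "m < N" for m t
    using y that by (auto simp: ode_solution_def nth_deriv_Suc simp flip: vector_derivative_works)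
  ultimately show ?case by simp
next
  case (Suc n)
  then have der: "(nth_deriv m y has_vector_derivative nth_deriv (Suc m) y t) (at t)"
    if "m < n + N" for m t
    using that by blast
  have eq: "nth_deriv (n + N) y = (\<lambda>t. -(\<Sum>k<N. (a k / a N) *\<^sub>R nth_deriv (n + k) y t))"
    using Suc by blast
  have der': "(nth_deriv (n + N) y has_vector_derivative
      -(\<Sum>k<N. (a k / a N) *\<^sub>R nth_deriv (Suc n + k) y t)) (at t)" for t
    unfolding eq
    by (intro has_vector_derivative_minus has_vector_derivative_sum
        bounded_linear.has_vector_derivative[OF bounded_linear_scaleR_right]) (auto intro: der)
  have "nth_deriv (Suc (n + N)) y =
      (\<lambda>t. -(\<Sum>k<N. (a k / a N) *\<^sub>R nth_deriv (Suc n + k) y t))"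
    by (rule nth_deriv_SucI) (rule der')
  then show ?case
    using der der' by (auto simp: less_Suc_eq)
qed

lemma ode_solution_recurrence:
  assumes "ode_solution N a y" "a N \<noteq> 0"
  shows "nth_deriv (n + N) y t = -(\<Sum>k<N. (a k / a N) *\<^sub>R nth_deriv (n + k) y t)"
  using ode_solution_recurrence_aux[OF assms] by blast

lemma ode_solution_has_derivative:
  assumes "ode_solution N a y" "a N \<noteq> 0"
  shows "(nth_deriv n y has_vector_derivative nth_deriv (Suc n) y t) (at t)"
  using ode_solution_recurrence_aux[OF assms, of "Suc n"] by simp

lemma ode_solution_has_real_derivative:
  assumes "ode_solution N a y" "a N \<noteq> 0"
  shows "(nth_deriv n y has_real_derivative nth_deriv (Suc n) y t) (at t)"
  using ode_solution_has_derivative[OF assms]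
  by (simp add: has_real_derivative_iff_has_vector_derivative)

text \<open>The recurrence at shift \<open>j\<close> is the equation for the \<open>j\<close>-th
  derivative. Hence the matrix entries at the endpoint \<open>T\<close> are themselves solutions, as
  functions of \<open>T\<close>.\<close>

lemma ode_solution_nth_deriv:
  assumes y: "ode_solution N a y" and aN: "a N \<noteq> 0"
  shows "ode_solution N a (nth_deriv j y)"
  unfolding ode_solution_def nth_deriv_nth_deriv
proof (intro conjI allI impI)
  show "nth_deriv (k + j) y differentiable at t" for k t
    using ode_solution_has_derivative[OF y aN] differentiableI_vector by blast
  have "a N *\<^sub>R nth_deriv (N + j) y t = -(\<Sum>k<N. a k *\<^sub>R nth_deriv (k + j) y t)" for t
    using ode_solution_recurrence[OF y aN, of j t] aN
    by (simp add: add.commute scaleR_right.sum)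
  then show "(\<Sum>k\<le>N. a k *\<^sub>R nth_deriv (k + j) y t) = 0" for t
    by (simp flip: lessThan_Suc_atMost)
qed

text \<open>The coefficients lie in a general algebra because the problem has complex ones, while
  Rolle's theorem needs real ones.\<close>

lemma nth_deriv_lincomb:
  fixes c :: "'i \<Rightarrow> 'a::real_normed_algebra_1"
  assumes "\<And>i k t. i \<in> I \<Longrightarrow>
    (nth_deriv k (f i) has_real_derivative nth_deriv (Suc k) (f i) t) (at t)"
  shows "nth_deriv k (\<lambda>t. \<Sum>i\<in>I. c i * of_real (f i t)) =
    (\<lambda>t. \<Sum>i\<in>I. c i * of_real (nth_deriv k (f i) t))"
proof (induction k)
  case (Suc k)
  show ?case
  proof (rule nth_deriv_SucI, unfold Suc)
    show "((\<lambda>t. \<Sum>i\<in>I. c i * of_real (nth_deriv k (f i) t)) has_vector_derivative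
        (\<Sum>i\<in>I. c i * of_real (nth_deriv (Suc k) (f i) t))) (at t)" for t
      by (intro has_vector_derivative_sum has_vector_derivative_mult_right
          has_vector_derivative_of_real assms)
  qed
qed simp

lemma ode_solution_lincomb:
  fixes c :: "'i \<Rightarrow> 'a::real_normed_algebra_1"
  assumes sol: "\<And>i. i \<in> I \<Longrightarrow> ode_solution N a (f i)" and aN: "a N \<noteq> 0"
  shows "ode_solution N a (\<lambda>t. \<Sum>i\<in>I. c i * of_real (f i t))"
proof -
  have der: "(nth_deriv k (f i) has_real_derivative nth_deriv (Suc k) (f i) t) (at t)"
    if "i \<in> I" for i k t
    by (rule ode_solution_has_real_derivative[OF sol[OF that] aN])
  have eq: "nth_deriv k (\<lambda>t. \<Sum>i\<in>I. c i * of_real (f i t)) =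
      (\<lambda>t. \<Sum>i\<in>I. c i * of_real (nth_deriv k (f i) t))" for k
    by (rule nth_deriv_lincomb) (rule der)
  have "((\<lambda>t. \<Sum>i\<in>I. c i * of_real (nth_deriv k (f i) t)) has_vector_derivative
      (\<Sum>i\<in>I. c i * of_real (nth_deriv (Suc k) (f i) t))) (at t)" for k t
    by (intro has_vector_derivative_sum has_vector_derivative_mult_right
        has_vector_derivative_of_real der)
  then have diff: "(\<lambda>t. \<Sum>i\<in>I. c i * of_real (nth_deriv k (f i) t)) differentiable at t" for k t
    using differentiableI_vector by blast
  have "(\<Sum>k\<le>N. a k *\<^sub>R (\<Sum>i\<in>I. c i * of_real (nth_deriv k (f i) t))) =
      (\<Sum>i\<in>I. c i * of_real (\<Sum>k\<le>N. a k * nth_deriv k (f i) t))" for t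
    unfolding scaleR_right.sum of_real_sum sum_distrib_left
    by (subst sum.swap) (simp add: of_real_def)
  also have "\<dots> t = 0" for t
    using sol by (intro sum.neutral ballI) (auto simp: ode_solution_def)
  finally show ?thesis
    using diff by (simp add: ode_solution_def eq)
qed

section \<open>Growth of derivatives and extension to entire functions\<close>

text \<open>From order \<open>N\<close> on, the recurrence costs a factor \<open>A\<close>, the sum
  of the coefficient moduli. The base is \<open>1 + A\<close> because its powers increase, so that
  one power dominates all lower orders.\<close>

lemma ode_solution_nth_deriv_bound:
  fixes y :: "real \<Rightarrow> real"
  assumes y: "ode_solution N a y" and aN: "a N \<noteq> 0"
    and B: "\<And>k. k < N \<Longrightarrow> \<bar>nth_deriv k y t\<bar> \<le> B" and B0: "0 \<le> B"
  shows "\<bar>nth_deriv n y t\<bar> \<le> B * (1 + (\<Sum>k<N. \<bar>a k / a N\<bar>)) ^ n"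
proof (induction n rule: less_induct)
  case (less n)
  define A where "A = (\<Sum>k<N. \<bar>a k / a N\<bar>)"
  have A: "A \<ge> 0" unfolding A_def by (intro sum_nonneg) auto
  show ?case
  proof (cases "n < N")
    case True
    have "B * 1 \<le> B * (1 + A) ^ n"
      using A B0 by (intro mult_left_mono one_le_power) auto
    then show ?thesis using B[OF True] by (simp add: A_def)
  next
    case False
    then obtain m where n: "n = m + N"
      using le_Suc_ex by (metis add.commute not_less)
    have "\<bar>nth_deriv n y t\<bar> \<le> (\<Sum>k<N. \<bar>a k / a N\<bar> * \<bar>nth_deriv (m + k) y t\<bar>)"
      unfolding n ode_solution_recurrence[OF y aN]
      by (simp add: abs_mult[symmetric] del: abs_divide)
    also have "\<dots> \<le> (\<Sum>k<N. \<bar>a k / a N\<bar> * (B * (1 + A) ^ (n - 1)))"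
    proof (intro sum_mono mult_left_mono)
      fix k assume k: "k \<in> {..<N}"
      have "\<bar>nth_deriv (m + k) y t\<bar> \<le> B * (1 + A) ^ (m + k)"
        using less[of "m + k"] k n by (simp add: A_def)
      also have "\<dots> \<le> B * (1 + A) ^ (n - 1)"
        using A B0 k n by (intro mult_left_mono power_increasing) auto
      finally show "\<bar>nth_deriv (m + k) y t\<bar> \<le> B * (1 + A) ^ (n - 1)" .
    qed auto
    also have "\<dots> = A * (B * (1 + A) ^ (n - 1))"
      by (simp add: A_def sum_distrib_right)
    also have "\<dots> \<le> (1 + A) * (B * (1 + A) ^ (n - 1))"
      using A B0 by (intro mult_right_mono) auto
    also have "\<dots> \<le> B * (1 + A) ^ n"
    proof (cases n)
      \<comment> \<open>Here \<open>n - 1\<close> is truncated; but then \<open>N = 0\<close> and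
        \<open>A\<close> is an empty sum.\<close>
      case 0
      then have "A = 0" using n by (simp add: A_def)
      then show ?thesis using B0 by simp
    qed (simp add: mult_ac)
    finally show ?thesis by (simp add: A_def)
  qed
qed

text \<open>Lagrange's remainder is at most \<open>B * ((L * \<bar>t\<bar>) ^ n / fact n)\<close>, a
  null sequence because the exponential series converges.\<close>

lemma ode_solution_sums:
  fixes y :: "real \<Rightarrow> real"
  assumes y: "ode_solution N a y" and aN: "a N \<noteq> 0"
  shows "(\<lambda>n. nth_deriv n y 0 / fact n * t ^ n) sums y t"
proof -
  note der = ode_solution_has_real_derivative[OF y aN]
  define L where "L = 1 + (\<Sum>k<N. \<bar>a k / a N\<bar>)"
  \<comment> \<open>The intermediate point of the remainder varies with \<open>n\<close> but stays
    in this compact set, so one \<open>B\<close> serves all \<open>n\<close>.\<close>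
  define K where "K = cball (0::real) \<bar>t\<bar>"
  have cont: "continuous_on K (\<lambda>s. \<Sum>k<N. \<bar>nth_deriv k y s\<bar>)"
    by (intro continuous_intros DERIV_continuous_on[OF has_field_derivative_at_within[OF der]])
  have "bounded ((\<lambda>s. \<Sum>k<N. \<bar>nth_deriv k y s\<bar>) ` K)"
    by (intro compact_imp_bounded compact_continuous_image cont) (simp add: K_def)
  then obtain B where B: "\<And>s. s \<in> K \<Longrightarrow> norm (\<Sum>k<N. \<bar>nth_deriv k y s\<bar>) \<le> B"
    by (auto simp: bounded_iff)
  have "0 \<in> K" by (simp add: K_def)
  then have B0: "0 \<le> B" using B[of 0] norm_ge_zero order_trans by blast
  have bound: "\<bar>nth_deriv n y s\<bar> \<le> B * L ^ n" if "s \<in> K" for n s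
    unfolding L_def
  proof (rule ode_solution_nth_deriv_bound[OF y aN _ B0])
    fix k assume "k < N"
    then have "\<bar>nth_deriv k y s\<bar> \<le> (\<Sum>k<N. \<bar>nth_deriv k y s\<bar>)"
      by (intro member_le_sum) auto
    also have "\<dots> \<le> B" using B[OF that] by simp
    finally show "\<bar>nth_deriv k y s\<bar> \<le> B" .
  qed
  have "(\<lambda>n. y t - (\<Sum>m<n. nth_deriv m y 0 / fact m * t ^ m)) \<longlonglongrightarrow> 0"
  proof (rule Lim_null_comparison)
    show "\<forall>\<^sub>F n in sequentially. norm (y t - (\<Sum>m<n. nth_deriv m y 0 / fact m * t ^ m))
        \<le> B * ((L * \<bar>t\<bar>) ^ n / fact n)"
    proof (intro always_eventually allI)
      fix n
      obtain s where s: "\<bar>s\<bar> \<le> \<bar>t\<bar>" and eq: "y t = (\<Sum>m<n. nth_deriv m y 0 / fact m * t ^ m) +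
          nth_deriv n y s / fact n * t ^ n"
        using Maclaurin_all_le[of "\<lambda>n. nth_deriv n y" y t n] der by auto
      have "norm (y t - (\<Sum>m<n. nth_deriv m y 0 / fact m * t ^ m)) =
          \<bar>nth_deriv n y s\<bar> * (\<bar>t\<bar> ^ n / fact n)"
        by (simp add: eq abs_mult power_abs)
      also have "\<dots> \<le> (B * L ^ n) * (\<bar>t\<bar> ^ n / fact n)"
        using bound[of s n] s by (intro mult_right_mono) (auto simp: K_def)
      finally show "norm (y t - (\<Sum>m<n. nth_deriv m y 0 / fact m * t ^ m))
          \<le> B * ((L * \<bar>t\<bar>) ^ n / fact n)"
        by (simp add: power_mult_distrib)
    qed
    show "(\<lambda>n. B * ((L * \<bar>t\<bar>) ^ n / fact n)) \<longlonglongrightarrow> 0"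
      using tendsto_mult_right_zero[OF summable_LIMSEQ_zero[OF summable_exp]]
      by (simp add: divide_inverse_commute)
  qed
  then have "(\<lambda>n. y t - (y t - (\<Sum>m<n. nth_deriv m y 0 / fact m * t ^ m))) \<longlonglongrightarrow> y t - 0"
    by (intro tendsto_diff tendsto_const)
  then show ?thesis by (simp add: sums_def)
qed

text \<open>A power series converging at every real point has infinite radius of convergence, so the
  Taylor series of \<open>y\<close> at 0 defines the extension.\<close>

lemma ode_solution_entire_extension:
  fixes y :: "real \<Rightarrow> real"
  assumes y: "ode_solution N a y" and aN: "a N \<noteq> 0"
  obtains g :: "complex \<Rightarrow> complex"
  where "g holomorphic_on UNIV" "\<And>t. g (of_real t) = of_real (y t)"
proof
  define c where "c n = complex_of_real (nth_deriv n y 0 / fact n)" for n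
  define g where "g z = (\<Sum>n. c n * z ^ n)" for z
  have real: "(\<lambda>n. c n * of_real t ^ n) sums of_real (y t)" for t
    using sums_of_real[OF ode_solution_sums[OF y aN, of t], where 'a = complex]
    by (simp add: c_def)
  have "summable (\<lambda>n. c n * z ^ n)" for z
  proof (rule powser_inside)
    show "summable (\<lambda>n. c n * complex_of_real (norm z + 1) ^ n)"
      by (rule sums_summable[OF real])
    show "norm z < norm (complex_of_real (norm z + 1))"
      by (simp only: norm_of_real)
  qed
  then have "(\<lambda>n. c n * (z - 0) ^ n) sums g z" for z
    by (simp add: g_def summable_sums)
  then have hol: "g holomorphic_on ball 0 r" for r
    by (rule power_series_holomorphic)
  have "g field_differentiable at z" for z
    by (rule holomorphic_on_imp_differentiable_at[OF hol[of "norm z + 1"]]) auto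
  then show "g holomorphic_on UNIV"
    by (simp add: holomorphic_on_def)
  show "g (of_real t) = of_real (y t)" for t
    using sums_unique[OF real[of t]] by (simp add: g_def)
qed

section \<open>Rolle's theorem and uniqueness on short intervals\<close>

text \<open>Points are added from left to right, each giving a zero between it and the previous
  maximum. Recording that the zeros lie strictly between points of \<open>S\<close> will keep them
  away from the endpoints of the interval.\<close>

lemma rolle_finite_zeros:
  fixes g g' :: "real \<Rightarrow> real"
  assumes der: "\<And>x. (g has_real_derivative g' x) (at x)"
    and "finite S" "\<forall>x\<in>S. g x = 0"
  shows "\<exists>S'. finite S' \<and> card S \<le> Suc (card S') \<and>
    (\<forall>x\<in>S'. g' x = 0 \<and> (\<exists>p\<in>S. \<exists>q\<in>S. p < x \<and> x < q))"
  using assms(2,3)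
proof (induction rule: finite_linorder_max_induct)
  case empty
  then show ?case by (intro exI[of _ "{}"]) auto
next
  case (insert b A)
  show ?case
  proof (cases "A = {}")
    case True
    then show ?thesis by (intro exI[of _ "{}"]) auto
  next
    case False
    obtain S' where S': "finite S'" "card A \<le> Suc (card S')"
      "\<forall>x\<in>S'. g' x = 0 \<and> (\<exists>p\<in>A. \<exists>q\<in>A. p < x \<and> x < q)"
      using insert by auto
    define m where "m = Max A"
    have m: "m \<in> A" "\<And>x. x \<in> A \<Longrightarrow> x \<le> m"
      using insert False by (auto simp: m_def)
    have "m < b" "g m = g b" using m insert by auto
    \<comment> \<open>\<open>Rolle_deriv\<close> takes derivatives as linear maps, here
      multiplication by \<open>g' x\<close>; evaluating at 1 recovers the number
      \<open>g' z\<close>.\<close>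
    then obtain z where z: "m < z" "z < b" "(*) (g' z) = (\<lambda>v. 0)"
      using Rolle_deriv[of m b g "\<lambda>x. (*) (g' x)"] der
        DERIV_continuous_on[OF has_field_derivative_at_within[OF der]]
      by (auto simp: has_field_derivative_def)
    have "g' z = 0" using fun_cong[OF z(3), of 1] by simp
    \<comment> \<open>Points of \<open>S'\<close> lie below some element of \<open>A\<close>, hence
      below \<open>m\<close>.\<close>
    have "z \<notin> S'" using S'(3) m(2) z(1) by fastforce
    then show ?thesis
      using S' z(1,2) \<open>g' z = 0\<close> m insert.hyps by (intro exI[of _ "insert z S'"]) (auto simp: card_insert_if)
  qed
qed

text \<open>If \<open>e\<^sub>k\<close> counts the endpoints at which the \<open>k\<close>-th derivative is prescribed to vanish, then
  Rolle turns \<open>s\<^sub>k\<close> interior zeros into \<open>s\<^sub>k + e\<^sub>k - 1\<close> interior zeros of the next derivative.\<close>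
lemma zero_of_derivative_two_point:
  fixes D :: "nat \<Rightarrow> real \<Rightarrow> real"
  assumes der: "\<And>k x. (D k has_real_derivative D (Suc k) x) (at x)"
    and T: "0 < T" and p: "\<And>i. i < p \<Longrightarrow> D i 0 = 0" and q: "\<And>i. i < q \<Longrightarrow> D i T = 0"
    and k: "k < p + q"
  shows "\<exists>x\<in>{0..T}. D k x = 0"
proof -
  define E where "E k = (if k < p then {0} else {}) \<union> (if k < q then {T} else {})" for k
  have E: "finite (E k)" "E k \<subseteq> {0..T}" "\<forall>x\<in>E k. D k x = 0" "E k \<inter> {0<..<T} = {}"
    "card (E k) = (if k < p then 1 else 0) + (if k < q then 1 else 0)" for k
    using p q T by (auto simp: E_def)
  \<comment> \<open>The left-hand side counts the conditions of order at most \<open>k\<close>; each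
    of the \<open>k\<close> uses of Rolle loses at most one zero, which the summand \<open>k\<close>
    compensates.\<close>
  have "\<exists>S. finite S \<and> S \<subseteq> {0..T} \<and> (\<forall>x\<in>S. D k x = 0) \<and>
      min (Suc k) p + min (Suc k) q \<le> card S + k" for k
  proof (induction k)
    case 0
    show ?case using E[of 0] by (intro exI[of _ "E 0"]) auto
  next
    case (Suc k)
    then obtain S where S: "finite S" "S \<subseteq> {0..T}" "\<forall>x\<in>S. D k x = 0"
      "min (Suc k) p + min (Suc k) q \<le> card S + k" by blast
    obtain S' where S': "finite S'" "card S \<le> Suc (card S')"
      "\<forall>x\<in>S'. D (Suc k) x = 0 \<and> (\<exists>p\<in>S. \<exists>q\<in>S. p < x \<and> x < q)"
      using rolle_finite_zeros[OF der S(1,3)] by blast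
    have S'': "S' \<subseteq> {0<..<T}"
      using S'(3) S(2) by fastforce
    have "card (S' \<union> E (Suc k)) = card S' + card (E (Suc k))"
      using S' S'' E[of "Suc k"] by (intro card_Un_disjoint) auto
    then have "min (Suc (Suc k)) p + min (Suc (Suc k)) q \<le> card (S' \<union> E (Suc k)) + Suc k"
      using S(4) S'(2) E(5)[of "Suc k"] by (auto split: if_splits)
    then show ?case
      using S' S'' E[of "Suc k"] by (intro exI[of _ "S' \<union> E (Suc k)"]) auto
  qed
  from this[of k] obtain S where S: "finite S" "S \<subseteq> {0..T}" "\<forall>x\<in>S. D k x = 0"
    "min (Suc k) p + min (Suc k) q \<le> card S + k" by blast
  \<comment> \<open>Either one minimum is \<open>Suc k\<close> or they add up to
    \<open>p + q\<close>; both exceed \<open>k\<close>.\<close>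
  have "card S > 0" using S(4) k by (auto simp: min_def split: if_splits)
  then show ?thesis using S by (metis card_gt_0_iff all_not_in_conv subsetD)
qed

text \<open>With \<open>A\<close> the coefficient sum and \<open>B\<close> the maximum of the
  \<open>N\<close>-th derivative, the equation gives \<open>B \<le> A * T * B\<close>, so
  \<open>A * T < 1\<close> forces \<open>B = 0\<close>. By \<open>T \<le> 1\<close> a single factor
  \<open>T\<close> serves for every lower order.\<close>

lemma ode_solution_two_point_short_interval:
  fixes y :: "real \<Rightarrow> real"
  assumes y: "ode_solution N a y" and aN: "a N \<noteq> 0"
    and T: "0 < T" "T \<le> 1" "(\<Sum>k<N. \<bar>a k / a N\<bar>) * T < 1"
    and p: "\<And>i. i < p \<Longrightarrow> nth_deriv i y 0 = 0" and q: "\<And>i. i < q \<Longrightarrow> nth_deriv i y T = 0"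
    and N: "p + q = N"
  shows "y t = 0"
proof -
  note der = ode_solution_has_real_derivative[OF y aN]
  define A where "A = (\<Sum>k<N. \<bar>a k / a N\<bar>)"
  have "continuous_on {0..T} (\<lambda>s. \<bar>nth_deriv N y s\<bar>)"
    by (intro continuous_intros DERIV_continuous_on[OF has_field_derivative_at_within[OF der]])
  then obtain s where s: "s \<in> {0..T}"
    and smax: "\<And>x. x \<in> {0..T} \<Longrightarrow> \<bar>nth_deriv N y x\<bar> \<le> \<bar>nth_deriv N y s\<bar>"
    using continuous_attains_sup[of "{0..T}" "\<lambda>s. \<bar>nth_deriv N y s\<bar>"] T by auto
  define B where "B = \<bar>nth_deriv N y s\<bar>"
  \<comment> \<open>Downward induction on the order: the mean value inequality, started at a zero of
    the \<open>k\<close>-th derivative, gains a factor \<open>T\<close>.\<close>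
  have "\<bar>nth_deriv (N - d) y x\<bar> \<le> T ^ d * B" if "d \<le> N" "x \<in> {0..T}" for d x
    using that
  proof (induction d arbitrary: x)
    case 0
    then show ?case using smax by (simp add: B_def)
  next
    case (Suc d)
    define k where "k = N - Suc d"
    have k: "Suc k = N - d" "k < p + q" using Suc N by (auto simp: k_def)
    obtain z where z: "z \<in> {0..T}" "nth_deriv k y z = 0"
      using zero_of_derivative_two_point[of "\<lambda>k. nth_deriv k y" T p q k] der T p q k by blast
    have "norm (nth_deriv k y x - nth_deriv k y z) \<le> (T ^ d * B) * norm (x - z)"
    proof (rule field_differentiable_bound[of "{0..T}"])
      show "(nth_deriv k y has_field_derivative nth_deriv (Suc k) y u) (at u within {0..T})" for u
        by (rule has_field_derivative_at_within[OF der])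
      show "norm (nth_deriv (Suc k) y u) \<le> T ^ d * B" if "u \<in> {0..T}" for u
        using Suc that by (simp add: k(1))
    qed (use z Suc in auto)
    also have "\<dots> \<le> (T ^ d * B) * T"
      using z Suc.prems T by (intro mult_left_mono) (auto simp: B_def)
    finally show ?case using z by (simp add: k_def mult_ac)
  qed
  note bound = this
  have low: "\<bar>nth_deriv k y x\<bar> \<le> T * B" if "k < N" "x \<in> {0..T}" for k x
  proof -
    have "\<bar>nth_deriv k y x\<bar> \<le> T ^ (N - k) * B"
      using bound[of "N - k" x] that by simp
    also have "\<dots> \<le> T ^ 1 * B"
      using T that by (intro mult_right_mono power_decreasing) (auto simp: B_def)
    finally show ?thesis by simp
  qed
  have "B \<le> (\<Sum>k<N. \<bar>a k / a N\<bar> * \<bar>nth_deriv k y s\<bar>)"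
    using ode_solution_recurrence[OF y aN, of 0 s]
    by (simp add: B_def abs_mult[symmetric] del: abs_divide)
  also have "\<dots> \<le> (\<Sum>k<N. \<bar>a k / a N\<bar> * (T * B))"
    using low s by (intro sum_mono mult_left_mono) auto
  also have "\<dots> = (A * T) * B"
    unfolding A_def sum_distrib_right by (simp only: mult.assoc)
  finally have "(1 - A * T) * B \<le> 0" by (simp add: algebra_simps)
  then have "B = 0"
    using T(3) by (simp add: A_def B_def mult_le_0_iff)
  \<comment> \<open>The data of order below \<open>N\<close> vanish at 0. The growth bound with
    constant 0 kills the other Taylor coefficients, so \<open>y\<close> vanishes on the whole
    line.\<close>
  then have "\<bar>nth_deriv k y 0\<bar> \<le> 0" if "k < N" for k
    using low[OF that, of 0] T by simp
  then have "\<bar>nth_deriv n y 0\<bar> \<le> 0" for n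
    using ode_solution_nth_deriv_bound[OF y aN, of 0 0 n] by simp
  then show ?thesis
    using sums_unique2[OF ode_solution_sums[OF y aN, of t]] by simp
qed

section \<open>The boundary matrix and isolated zeros of its determinant\<close>

text \<open>A single row index for all conditions, those at \<open>T\<close> following the
  \<open>M + 1\<close> at 0; polymorphic so as to apply to real basis functions and complex
  solutions alike.\<close>

definition bvp_datum :: "nat \<Rightarrow> real \<Rightarrow> nat \<Rightarrow> (real \<Rightarrow> 'a::real_normed_vector) \<Rightarrow> 'a" where
  "bvp_datum M T r y = (if r \<le> M then nth_deriv r y 0 else nth_deriv (r - Suc M) y T)"

text \<open>This is W(T), complex because the unknown coefficients are. Columns are numbered from 0,
  the basis from 1.\<close>

definition bvp_matrix :: "nat \<Rightarrow> (nat \<Rightarrow> real \<Rightarrow> real) \<Rightarrow> nat \<Rightarrow> real \<Rightarrow> complex mat" where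
  "bvp_matrix N \<sigma> M T = mat N N (\<lambda>(r, i). of_real (bvp_datum M T r (\<sigma> (Suc i))))"

lemma bvp_conditions_iff:
  assumes "M < N"
  shows "(\<forall>r<N. bvp_datum M T r y = (if r \<le> M then u r else v (r - Suc M))) \<longleftrightarrow>
    (\<forall>i\<le>M. nth_deriv i y 0 = u i) \<and> (\<forall>j<N - M - 1. nth_deriv j y T = v j)"
    (is "?L \<longleftrightarrow> ?R")
proof
  assume L: ?L
  have "nth_deriv j y T = v j" if "j < N - M - 1" for j
    using L[rule_format, of "j + Suc M"] that by (simp add: bvp_datum_def)
  moreover have "nth_deriv i y 0 = u i" if "i \<le> M" for i
    using L[rule_format, of i] that assms by (simp add: bvp_datum_def)
  ultimately show ?R by blast
qed (use assms in \<open>auto simp: bvp_datum_def\<close>)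

lemma det_holomorphic_on:
  fixes A :: "complex \<Rightarrow> complex mat"
  assumes "\<And>z. A z \<in> carrier_mat n n"
    and "\<And>i j. i < n \<Longrightarrow> j < n \<Longrightarrow> (\<lambda>z. A z $$ (i, j)) holomorphic_on S"
  shows "(\<lambda>z. det (A z)) holomorphic_on S"
proof -
  have "(\<lambda>z. A z $$ (i, p i)) holomorphic_on S" if "p permutes {0..<n}" "i < n" for p i
    using assms(2)[of i "p i"] permutes_in_image[OF that(1), of i] that(2) by simp
  then show ?thesis
    unfolding det_def'[OF assms(1)] by (auto intro!: holomorphic_intros)
qed

text \<open>The point \<open>\<beta>\<close> rules out the zero function, so zeros are isolated in
  the plane and all the more on the real line.\<close>

lemma real_zeros_discrete:
  fixes F :: "complex \<Rightarrow> complex"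
  assumes "F holomorphic_on UNIV" and "F \<beta> \<noteq> 0"
  shows "discrete {t :: real. F (of_real t) = 0}"
  unfolding discrete_def
proof
  fix t assume t: "t \<in> {t. F (complex_of_real t) = 0}"
  obtain r where r: "0 < r" "\<And>z. z \<in> ball (of_real t) r - {of_real t} \<Longrightarrow> F z \<noteq> 0"
    using isolated_zeros[OF assms(1), of "of_real t" \<beta>] assms(2) t by auto
  have "s = t" if "dist t s < r" "F (of_real s) = 0" for s
    using r(2)[of "of_real s"] that by (auto simp: dist_of_real)
  then show "t isolated_in {t. F (complex_of_real t) = 0}"
    using t r(1) unfolding isolated_in_dist_Ex_iff by auto
qed

section \<open>Solvability in terms of the determinant\<close>

context
  fixes N M :: nat and a :: "nat \<Rightarrow> real" and \<sigma> :: "nat \<Rightarrow> real \<Rightarrow> real"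
  assumes aN: "a N \<noteq> 0" and \<sigma>: "\<And>i. i \<in> {1..N} \<Longrightarrow> ode_solution N a (\<sigma> i)"
begin

lemma bvp_datum_lincomb:
  fixes c :: "nat \<Rightarrow> 'a::real_normed_algebra_1"
  shows "bvp_datum M T r (\<lambda>t. \<Sum>i=1..N. c i * of_real (\<sigma> i t)) =
    (\<Sum>i=1..N. c i * of_real (bvp_datum M T r (\<sigma> i)))"
proof -
  have "nth_deriv k (\<lambda>t. \<Sum>i=1..N. c i * of_real (\<sigma> i t)) =
      (\<lambda>t. \<Sum>i=1..N. c i * of_real (nth_deriv k (\<sigma> i) t))" for k
    by (rule nth_deriv_lincomb) (rule ode_solution_has_real_derivative[OF \<sigma> aN])
  then show ?thesis by (simp add: bvp_datum_def)
qed

text \<open>This turns the boundary conditions into a linear system for the coefficients.\<close>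

lemma bvp_matrix_mult_vec:
  fixes c :: "nat \<Rightarrow> complex"
  shows "bvp_matrix N \<sigma> M T *\<^sub>v vec N (\<lambda>i. c (Suc i)) =
    vec N (\<lambda>r. bvp_datum M T r (\<lambda>t. \<Sum>i=1..N. c i * of_real (\<sigma> i t)))"
  unfolding bvp_datum_lincomb
  by (intro eq_vecI) (simp_all add: bvp_matrix_def scalar_prod_def sum.atLeast1_atMost_eq
      atLeast0LessThan mult.commute)

text \<open>By this implication the exceptional set lies among the zeros of the determinant. The
  right inverse of the matrix gives existence, the left inverse uniqueness of the
  coefficients.\<close>

lemma bvp_uniquely_solvable_if_det_nonzero:
  assumes M: "M < N" and det: "det (bvp_matrix N \<sigma> M T) \<noteq> 0"
  shows "bvp_uniquely_solvable N a \<sigma> M T"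
  unfolding bvp_uniquely_solvable_def
proof (intro allI)
  fix u v :: "nat \<Rightarrow> complex"
  define W where "W = bvp_matrix N \<sigma> M T"
  define b where "b = vec N (\<lambda>r. if r \<le> M then u r else v (r - Suc M))"
  have W: "W \<in> carrier_mat N N" by (simp add: W_def bvp_matrix_def)
  \<comment> \<open>Combinations of the \<open>\<sigma> i\<close> satisfy the equation
    automatically, so only the linear system remains.\<close>
  have sol: "bvp_solution N a \<sigma> M T u v y \<longleftrightarrow>
      (\<exists>c. y = (\<lambda>t. \<Sum>i=1..N. c i * of_real (\<sigma> i t)) \<and> W *\<^sub>v vec N (\<lambda>i. c (Suc i)) = b)" for y
  proof -
    have "W *\<^sub>v vec N (\<lambda>i. c (Suc i)) = b \<longleftrightarrow>
        (\<forall>i\<le>M. nth_deriv i y 0 = u i) \<and> (\<forall>j<N - M - 1. nth_deriv j y T = v j)"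
      if y: "y = (\<lambda>t. \<Sum>i=1..N. c i * of_real (\<sigma> i t))" for c
    proof -
      have eq: "W *\<^sub>v vec N (\<lambda>i. c (Suc i)) = vec N (\<lambda>r. bvp_datum M T r y)"
        unfolding W_def y by (rule bvp_matrix_mult_vec)
      have "W *\<^sub>v vec N (\<lambda>i. c (Suc i)) = b \<longleftrightarrow>
          (\<forall>r<N. bvp_datum M T r y = (if r \<le> M then u r else v (r - Suc M)))"
        unfolding eq by (auto simp: b_def vec_eq_iff)
      also note bvp_conditions_iff[OF M]
      finally show ?thesis .
    qed
    moreover have "ode_solution N a y"
      if "y = (\<lambda>t. \<Sum>i=1..N. c i * of_real (\<sigma> i t))" for c
      unfolding that by (rule ode_solution_lincomb[where N = N, OF \<sigma> aN])
    moreover have "(\<exists>c. \<forall>t. y t = (\<Sum>i=1..N. c i * of_real (\<sigma> i t))) \<longleftrightarrow>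
        (\<exists>c. y = (\<lambda>t. \<Sum>i=1..N. c i * of_real (\<sigma> i t)))"
      by (simp only: fun_eq_iff)
    ultimately show ?thesis
      unfolding bvp_solution_def by (simp only:) blast
  qed
  obtain B where B: "B \<in> carrier_mat N N" "W * B = 1\<^sub>m N" "B * W = 1\<^sub>m N"
    using det_non_zero_imp_unit[OF W, of "()"] det
    by (auto simp: W_def Units_def ring_mat_def)
  show "\<exists>!y. bvp_solution N a \<sigma> M T u v y"
  proof (rule ex_ex1I)
    define c where "c i = (B *\<^sub>v b) $ (i - 1)" for i
    have "vec N (\<lambda>i. c (Suc i)) = B *\<^sub>v b"
      using B by (auto simp: c_def)
    moreover have "W *\<^sub>v (B *\<^sub>v b) = b"
      using B W by (simp add: assoc_mult_mat_vec[symmetric] b_def)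
    ultimately have "W *\<^sub>v vec N (\<lambda>i. c (Suc i)) = b" by simp
    then show "\<exists>y. bvp_solution N a \<sigma> M T u v y"
      unfolding sol by blast
  next
    fix y y' assume "bvp_solution N a \<sigma> M T u v y" "bvp_solution N a \<sigma> M T u v y'"
    then obtain c c' where y: "y = (\<lambda>t. \<Sum>i=1..N. c i * of_real (\<sigma> i t))"
        "y' = (\<lambda>t. \<Sum>i=1..N. c' i * of_real (\<sigma> i t))"
      and "W *\<^sub>v vec N (\<lambda>i. c (Suc i)) = b" "W *\<^sub>v vec N (\<lambda>i. c' (Suc i)) = b"
      unfolding sol by blast
    then have "B *\<^sub>v (W *\<^sub>v vec N (\<lambda>i. c (Suc i))) = B *\<^sub>v (W *\<^sub>v vec N (\<lambda>i. c' (Suc i)))"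
      by simp
    then have "vec N (\<lambda>i. c (Suc i)) = vec N (\<lambda>i. c' (Suc i))"
      using B W by (simp add: assoc_mult_mat_vec[symmetric])
    then have "c (Suc i) = c' (Suc i)" if "i < N" for i
      using that by (metis index_vec)
    then show "y = y'"
      unfolding y by (simp add: sum.atLeast1_atMost_eq)
  qed
qed

text \<open>A kernel vector may be complex, but the data of the \<open>\<sigma> i\<close> are real,
  so its real and imaginary parts are in the kernel too. Each defines a real solution with zero
  data, which vanishes because \<open>T\<close> is small; independence then kills the
  coefficients.\<close>

lemma det_bvp_matrix_nonzero_at_short_horizon:
  assumes indep: "\<And>c :: nat \<Rightarrow> real.
      \<forall>t. (\<Sum>i=1..N. c i * \<sigma> i t) = 0 \<Longrightarrow> \<forall>i\<in>{1..N}. c i = 0"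
    and M: "M < N"
    and T: "0 < T" "T \<le> 1" "(\<Sum>k<N. \<bar>a k / a N\<bar>) * T < 1"
  shows "det (bvp_matrix N \<sigma> M T) \<noteq> 0"
proof
  assume "det (bvp_matrix N \<sigma> M T) = 0"
  then obtain w where w: "w \<in> carrier_vec N" "w \<noteq> 0\<^sub>v N" "bvp_matrix N \<sigma> M T *\<^sub>v w = 0\<^sub>v N"
    using det_0_iff_vec_prod_zero[of "bvp_matrix N \<sigma> M T" N] by (auto simp: bvp_matrix_def)
  define c where "c i = w $ (i - 1)" for i
  have w_eq: "w = vec N (\<lambda>i. c (Suc i))"
    using w(1) by (auto simp: c_def)
  have datum: "(\<Sum>i=1..N. c i * of_real (bvp_datum M T r (\<sigma> i))) = 0" if "r < N" for r
    using w(3) that unfolding w_eq bvp_matrix_mult_vec bvp_datum_lincomb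
    by (auto simp: vec_eq_iff)
  have zero: "\<forall>i\<in>{1..N}. d i = 0"
    if d: "\<And>r. r < N \<Longrightarrow> (\<Sum>i=1..N. d i * bvp_datum M T r (\<sigma> i)) = 0" for d :: "nat \<Rightarrow> real"
  proof (rule indep, rule allI)
    fix t
    define y where "y = (\<lambda>t. \<Sum>i=1..N. d i * of_real (\<sigma> i t))"
    have y: "ode_solution N a y"
      unfolding y_def by (rule ode_solution_lincomb[where N = N, OF \<sigma> aN])
    have "bvp_datum M T r y = 0" if "r < N" for r
      using d[OF that] bvp_datum_lincomb[of T r d] by (simp add: y_def)
    then have "(\<forall>i\<le>M. nth_deriv i y 0 = 0) \<and> (\<forall>j<N - M - 1. nth_deriv j y T = 0)"
      using bvp_conditions_iff[OF M, of T y "\<lambda>_. 0" "\<lambda>_. 0"] by simp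
    then have "y t = 0"
      using ode_solution_two_point_short_interval[OF y aN T, of "Suc M" "N - M - 1"] M by auto
    then show "(\<Sum>i=1..N. d i * \<sigma> i t) = 0" by (simp add: y_def)
  qed
  have "\<forall>i\<in>{1..N}. Re (c i) = 0"
    using arg_cong[OF datum, of _ Re] by (intro zero) simp
  moreover have "\<forall>i\<in>{1..N}. Im (c i) = 0"
    using arg_cong[OF datum, of _ Im] by (intro zero) simp
  ultimately have "w = 0\<^sub>v N"
    unfolding w_eq by (auto simp: complex_eq_iff)
  with w(2) show False ..
qed

text \<open>Rows of data at 0 are constant in \<open>T\<close>; the other entries are derivatives of
  solutions, hence solutions in \<open>T\<close>, and extend to entire functions.\<close>

lemma det_bvp_matrix_entire_extension:
  obtains F where "F holomorphic_on UNIV" "\<And>T. F (of_real T) = det (bvp_matrix N \<sigma> M T)"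
proof -
  have "\<exists>g. g holomorphic_on UNIV \<and> (\<forall>T. g (of_real T) = complex_of_real (bvp_datum M T r (\<sigma> (Suc i))))"
    if "i < N" for r i
  proof (cases "r \<le> M")
    case True
    then show ?thesis
      by (intro exI[of _ "\<lambda>_. of_real (nth_deriv r (\<sigma> (Suc i)) 0)"]) (auto simp: bvp_datum_def)
  next
    case False
    have "ode_solution N a (nth_deriv (r - Suc M) (\<sigma> (Suc i)))"
      using \<sigma> aN that by (intro ode_solution_nth_deriv) auto
    from ode_solution_entire_extension[OF this aN] False show ?thesis
      by (metis bvp_datum_def)
  qed
  note ex = this
  define g where "g r i = (SOME g. g holomorphic_on UNIV \<and>
    (\<forall>T. g (of_real T) = complex_of_real (bvp_datum M T r (\<sigma> (Suc i)))))" for r i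
  have g: "g r i holomorphic_on UNIV"
    "g r i (of_real T) = complex_of_real (bvp_datum M T r (\<sigma> (Suc i)))" if "i < N" for r i T
    using someI_ex[OF ex[OF that, of r]] by (simp_all add: g_def)
  show ?thesis
  proof
    show "(\<lambda>z. det (mat N N (\<lambda>(r, i). g r i z))) holomorphic_on UNIV"
      using g(1) by (intro det_holomorphic_on) auto
    have "mat N N (\<lambda>(r, i). g r i (of_real T)) = bvp_matrix N \<sigma> M T" for T
      using g(2) by (auto simp: bvp_matrix_def)
    then show "det (mat N N (\<lambda>(r, i). g r i (of_real T))) = det (bvp_matrix N \<sigma> M T)" for T
      by simp
  qed
qed

end

theorem proposition14:
  fixes N M :: nat and a :: "nat \<Rightarrow> real" and \<sigma> :: "nat \<Rightarrow> real \<Rightarrow> real"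
  assumes "N \<ge> 1"
    and "a N \<noteq> 0"
    and "solution_basis N a \<sigma>"
    and "M < N"
  shows "bvp_almost_always_solvable N a \<sigma> M"
proof -
  have \<sigma>: "ode_solution N a (\<sigma> i)" if "i \<in> {1..N}" for i
    using assms(3) that by (simp add: solution_basis_def)
  obtain F where F: "F holomorphic_on UNIV" "\<And>T. F (of_real T) = det (bvp_matrix N \<sigma> M T)"
    using det_bvp_matrix_entire_extension[of a N \<sigma> M] assms(2) \<sigma> by metis
  define A where "A = (\<Sum>k<N. \<bar>a k / a N\<bar>)"
  have "A \<ge> 0" unfolding A_def by (intro sum_nonneg) auto
  \<comment> \<open>An explicit horizon that is short enough, as
    \<open>A / (1 + A) < 1\<close>.\<close>
  then have T: "0 < 1 / (1 + A)" "1 / (1 + A) \<le> 1" "A * (1 / (1 + A)) < 1"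
    by (auto simp: field_simps)
  have "det (bvp_matrix N \<sigma> M (1 / (1 + A))) \<noteq> 0"
    using assms \<sigma> T unfolding A_def
    by (intro det_bvp_matrix_nonzero_at_short_horizon[of a]) (auto simp: solution_basis_def)
  then have "discrete {t. F (complex_of_real t) = 0}"
    using real_zeros_discrete[OF F(1)] F(2) by metis
  \<comment> \<open>Inclusion suffices, since isolation of points passes to subsets.\<close>
  moreover have "{T. T > 0 \<and> \<not> bvp_uniquely_solvable N a \<sigma> M T} \<subseteq> {t. F (complex_of_real t) = 0}"
    using bvp_uniquely_solvable_if_det_nonzero[of a N \<sigma> M] assms \<sigma> F(2) by auto
  ultimately show ?thesis
    unfolding bvp_almost_always_solvable_def discrete_def using isolated_in_subset by blast
qed

end
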